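(* Let $\mathbb{D}$ be an $\mathbb{F}_1$-composable class of filters. Let $(X,\xi)$ and $(Y,\tau)$ be convergence spaces and let $f:(X,\xi)\to(Y,\tau)$ be a surjection. The following are equivalent: (1) $f:(X,\xi)\to(Y,\tau)$ is $\mathbb{D}$-quotient; (2) $\tau\geq \mathrm{Adh}_{\mathbb{D}}(f\xi)$; (3) $f:(X,f^{-}\tau)\to(Y,f\xi)$ is a $\mathbb{D}$-compact relation.
   Context: Filters and classes. For filters, $\mathcal{F}\leq\mathcal{G}$ means $\mathcal{F}\subset\mathcal{G}$. Families $\mathcal{A},\mathcal{B}$ of subsets of a set mesh, $\mathcal{A}\#\mathcal{B}$, if $A\cap B\neq\emptyset$ for all $A\in\mathcal{A}$, $B\in\mathcal{B}$ (for a single set $A$, $A\#\mathcal{B}$ means $\{A\}\#\mathcal{B}$). $\mathcal{A}^{\uparrow}$ is the family of supersets of members of $\mathcal{A}$. A class of filters $\mathbb{D}$ assigns to each set $X$ a collection $\mathbb{D}(X)$ of filters on $X$; by convention every class contains the degenerate filter $2^X$. $\mathbb{F}_1$ is the class of principal filters. $\mathbb{D}$ is $\mathbb{F}_1$-composable if for all sets $X,Y$, every $\mathcal{F}\in\mathbb{D}(X)$ and every $H\subset X\times Y$, the (possibly degenerate) filter generated by $\{HF:F\in\mathcal{F}\}$ is in $\mathbb{D}(Y)$, where $HF=\{y:\exists x\in F,\ (x,y)\in H\}$. Convergence spaces. A convergence $\xi$ on $X$ is a relation between (proper) filters on $X$ and points of $X$, written $x\in\lim_\xi\mathcal{F}$,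 such that $\mathcal{F}\leq\mathcal{G}$ implies $\lim_\xi\mathcal{F}\subset\lim_\xi\mathcal{G}$; $x\in\lim_\xi\{x\}^{\uparrow}$ for all $x$; and $\lim_\xi(\mathcal{F}\wedge\mathcal{G})=\lim_\xi\mathcal{F}\cap\lim_\xi\mathcal{G}$, where $\mathcal{F}\wedge\mathcal{G}=\mathcal{F}\cap\mathcal{G}$. A map $f:(X,\xi)\to(Y,\tau)$ is continuous if $f(\lim_\xi\mathcal{F})\subset\lim_\tau f(\mathcal{F})$ for all $\mathcal{F}$. $\xi\geq\theta$ means $\lim_\xi\mathcal{F}\subset\lim_\theta\mathcal{F}$ for all $\mathcal{F}$ ($\xi$ is finer). $f\xi$ (final convergence) is the finest convergence on $Y$ making $f:(X,\xi)\to Y$ continuous; $f^{-}\tau$ (initial convergence) is the coarsest convergence on $X$ making $f:X\to(Y,\tau)$ continuous. $\mathrm{adh}_\xi\mathcal{F}=\bigcup_{\mathcal{G}\#\mathcal{F}}\lim_\xi\mathcal{G}$, and $\lim_{\mathrm{Adh}_{\mathbb{D}}\xi}\mathcal{F}=\bigcap\{\mathrm{adh}_\xi\mathcal{D}:\mathcal{D}\in\mathbb{D}(X),\ \mathcal{D}\#\mathcal{F}\}$. Compactness. A filter $\mathcal{F}$ is $\mathbb{D}$-compact at $A\subset X$ (for $\xi$) if $\mathcal{D}\in\mathbb{D}(X)$, $\mathcal{D}\#\mathcal{F}$ imply $\mathrm{adh}_\xi\mathcal{D}\cap A\neq\emptyset$. A relation $R:(X,\xi)\rightrightarrows(Y,\tau)$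 is $\mathbb{D}$-compact if for every $A\subset X$ and every filter $\mathcal{F}$ that is $\mathbb{D}$-compact at $A$ for $\xi$, the filter $R\mathcal{F}$ generated by $\{RF:F\in\mathcal{F}\}$ is $\mathbb{D}$-compact at $RA$ for $\tau$. A map is regarded as a relation. A surjection $f:(X,\xi)\to(Y,\tau)$ is $\mathbb{D}$-quotient if for every $\mathcal{H}\in\mathbb{D}(Y)$ and $y\in Y$: $y\in\mathrm{adh}_\tau\mathcal{H}$ implies $f^{-}(y)\cap\mathrm{adh}_\xi f^{-}\mathcal{H}\neq\emptyset$, where $f^{-}$ denotes preimage and $f^{-}\mathcal{H}$ is the filter generated by $\{f^{-}(H):H\in\mathcal{H}\}$. *)

theory Defs
  imports Complex_Main
begin

(*
  All sets of points are subsets X, Y, ... of an arbitrary type 'u, so that "for all sets X, Y"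
  can be quantified over inside a formula.

  A possibly degenerate filter on X is a value F :: 'u filter with F \<le> principal X, i.e. with
  X as an element; the degenerate filter (all subsets of X) is bot.  The order of the type
  'u filter is reverse inclusion of filters: "G is a finer filter than F" is written G \<le> F,
  and the intersection of the filters F and G is sup F G.
*)

definition filter_sets :: "'u filter \<Rightarrow> 'u set set" where
  "filter_sets F = {A. eventually (\<lambda>x. x \<in> A) F}"

definition filter_on :: "'u set \<Rightarrow> 'u filter \<Rightarrow> bool" where
  "filter_on X F \<longleftrightarrow> F \<le> principal X"

definition proper_filter_on :: "'u set \<Rightarrow> 'u filter \<Rightarrow> bool" where
  "proper_filter_on X F \<longleftrightarrow> filter_on X F \<and> F \<noteq> bot"

definition mesh :: "'u filter \<Rightarrow> 'u filter \<Rightarrow> bool" where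
  "mesh F G \<longleftrightarrow> (\<forall>A\<in>filter_sets F. \<forall>B\<in>filter_sets G. A \<inter> B \<noteq> {})"

(* The least filter containing all members of B; for the bases used below this is the
   family of supersets of members of B (see filter_sets_rel_filter_image, filter_sets_preimage_filter). *)
definition generated_filter :: "'u set set \<Rightarrow> 'u filter" where
  "generated_filter B = (INF S\<in>B. principal S)"

definition rel_filter_image :: "('u \<times> 'u) set \<Rightarrow> 'u filter \<Rightarrow> 'u filter" where
  "rel_filter_image H F = generated_filter {H `` S |S. S \<in> filter_sets F}"

definition preimage_filter :: "'u set \<Rightarrow> ('u \<Rightarrow> 'u) \<Rightarrow> 'u filter \<Rightarrow> 'u filter" where
  "preimage_filter X f F = generated_filter {X \<inter> f -` S |S. S \<in> filter_sets F}"

definition graph_on :: "'u set \<Rightarrow> ('u \<Rightarrow> 'u) \<Rightarrow> ('u \<times> 'u) set" where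
  "graph_on X f = {(x, f x) |x. x \<in> X}"

type_synonym 'u filter_class = "'u set \<Rightarrow> 'u filter set"

definition is_filter_class :: "'u filter_class \<Rightarrow> bool" where
  "is_filter_class D \<longleftrightarrow> (\<forall>X. bot \<in> D X \<and> (\<forall>F\<in>D X. filter_on X F))"

definition F1_composable :: "'u filter_class \<Rightarrow> bool" where
  "F1_composable D \<longleftrightarrow>
     (\<forall>X Y. \<forall>F\<in>D X. \<forall>H. H \<subseteq> X \<times> Y \<longrightarrow> rel_filter_image H F \<in> D Y)"

(* A convergence is given by its limit function. Requiring the value {} off the proper filters
   on X makes equality of limit functions coincide with equality of convergences. *)
type_synonym 'u limit_fun = "'u filter \<Rightarrow> 'u set"

definition convergence_on :: "'u set \<Rightarrow> 'u limit_fun \<Rightarrow> bool" where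
  "convergence_on X \<xi> \<longleftrightarrow>
     (\<forall>F. \<xi> F \<subseteq> X) \<and>
     (\<forall>F. \<not> proper_filter_on X F \<longrightarrow> \<xi> F = {}) \<and>
     (\<forall>F G. proper_filter_on X F \<longrightarrow> proper_filter_on X G \<longrightarrow> G \<le> F \<longrightarrow> \<xi> F \<subseteq> \<xi> G) \<and>
     (\<forall>x\<in>X. x \<in> \<xi> (principal {x})) \<and>
     (\<forall>F G. proper_filter_on X F \<longrightarrow> proper_filter_on X G \<longrightarrow> \<xi> (sup F G) = \<xi> F \<inter> \<xi> G)"

definition finer_convergence :: "'u limit_fun \<Rightarrow> 'u limit_fun \<Rightarrow> bool" where
  "finer_convergence \<xi> \<theta> \<longleftrightarrow> (\<forall>F. \<xi> F \<subseteq> \<theta> F)"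

definition continuous_conv ::
    "'u set \<Rightarrow> 'u limit_fun \<Rightarrow> 'u set \<Rightarrow> 'u limit_fun \<Rightarrow> ('u \<Rightarrow> 'u) \<Rightarrow> bool" where
  "continuous_conv X \<xi> Y \<tau> f \<longleftrightarrow>
     f ` X \<subseteq> Y \<and> (\<forall>F. proper_filter_on X F \<longrightarrow> f ` \<xi> F \<subseteq> \<tau> (filtermap f F))"

definition is_final_convergence ::
    "'u set \<Rightarrow> 'u limit_fun \<Rightarrow> 'u set \<Rightarrow> ('u \<Rightarrow> 'u) \<Rightarrow> 'u limit_fun \<Rightarrow> bool" where
  "is_final_convergence X \<xi> Y f \<theta> \<longleftrightarrow>
     convergence_on Y \<theta> \<and> continuous_conv X \<xi> Y \<theta> f \<and>
     (\<forall>\<theta>'. convergence_on Y \<theta>' \<longrightarrow> continuous_conv X \<xi> Y \<theta>' f \<longrightarrow> finer_convergence \<theta> \<theta>')"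

definition final_convergence ::
    "'u set \<Rightarrow> 'u limit_fun \<Rightarrow> 'u set \<Rightarrow> ('u \<Rightarrow> 'u) \<Rightarrow> 'u limit_fun" where
  "final_convergence X \<xi> Y f = (THE \<theta>. is_final_convergence X \<xi> Y f \<theta>)"

definition is_initial_convergence ::
    "'u set \<Rightarrow> 'u set \<Rightarrow> 'u limit_fun \<Rightarrow> ('u \<Rightarrow> 'u) \<Rightarrow> 'u limit_fun \<Rightarrow> bool" where
  "is_initial_convergence X Y \<tau> f \<theta> \<longleftrightarrow>
     convergence_on X \<theta> \<and> continuous_conv X \<theta> Y \<tau> f \<and>
     (\<forall>\<theta>'. convergence_on X \<theta>' \<longrightarrow> continuous_conv X \<theta>' Y \<tau> f \<longrightarrow> finer_convergence \<theta>' \<theta>)"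

definition initial_convergence ::
    "'u set \<Rightarrow> 'u set \<Rightarrow> 'u limit_fun \<Rightarrow> ('u \<Rightarrow> 'u) \<Rightarrow> 'u limit_fun" where
  "initial_convergence X Y \<tau> f = (THE \<theta>. is_initial_convergence X Y \<tau> f \<theta>)"

definition adh :: "'u set \<Rightarrow> 'u limit_fun \<Rightarrow> 'u filter \<Rightarrow> 'u set" where
  "adh X \<xi> F = (\<Union>G\<in>{G. proper_filter_on X G \<and> mesh G F}. \<xi> G)"

(* The intersection is taken inside X: it is X when no filter of the class meshes with F. *)
definition Adh :: "'u filter_class \<Rightarrow> 'u set \<Rightarrow> 'u limit_fun \<Rightarrow> 'u limit_fun" where
  "Adh D X \<xi> F =
     (if proper_filter_on X F then {x\<in>X. \<forall>H\<in>D X. mesh H F \<longrightarrow> x \<in> adh X \<xi> H} else {})"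

definition D_compact_at ::
    "'u filter_class \<Rightarrow> 'u set \<Rightarrow> 'u limit_fun \<Rightarrow> 'u filter \<Rightarrow> 'u set \<Rightarrow> bool" where
  "D_compact_at D X \<xi> F A \<longleftrightarrow> (\<forall>H\<in>D X. mesh H F \<longrightarrow> adh X \<xi> H \<inter> A \<noteq> {})"

definition D_compact_relation ::
    "'u filter_class \<Rightarrow> 'u set \<Rightarrow> 'u limit_fun \<Rightarrow> 'u set \<Rightarrow> 'u limit_fun \<Rightarrow> ('u \<times> 'u) set \<Rightarrow> bool"
  where
  "D_compact_relation D X \<xi> Y \<tau> R \<longleftrightarrow>
     R \<subseteq> X \<times> Y \<and>
     (\<forall>A F. A \<subseteq> X \<longrightarrow> filter_on X F \<longrightarrow> D_compact_at D X \<xi> F A \<longrightarrow>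
        D_compact_at D Y \<tau> (rel_filter_image R F) (R `` A))"

definition D_quotient ::
    "'u filter_class \<Rightarrow> 'u set \<Rightarrow> 'u limit_fun \<Rightarrow> 'u set \<Rightarrow> 'u limit_fun \<Rightarrow> ('u \<Rightarrow> 'u) \<Rightarrow> bool" where
  "D_quotient D X \<xi> Y \<tau> f \<longleftrightarrow>
     f ` X = Y \<and>
     (\<forall>H\<in>D Y. \<forall>y\<in>Y. y \<in> adh Y \<tau> H \<longrightarrow>
        (X \<inter> f -` {y}) \<inter> adh X \<xi> (preimage_filter X f H) \<noteq> {})"


lemma eventually_generated_filter:
  assumes "B \<noteq> {}" and "\<And>S T. S \<in> B \<Longrightarrow> T \<in> B \<Longrightarrow> \<exists>U\<in>B. U \<subseteq> S \<inter> T"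
  shows "eventually P (generated_filter B) \<longleftrightarrow> (\<exists>S\<in>B. \<forall>x\<in>S. P x)"
  unfolding generated_filter_def
  using assms by (subst eventually_INF_base) (auto simp: eventually_principal)

lemma filter_sets_UNIV: "UNIV \<in> filter_sets F"
  by (simp add: filter_sets_def)

lemma filter_sets_Int: "S \<in> filter_sets F \<Longrightarrow> T \<in> filter_sets F \<Longrightarrow> S \<inter> T \<in> filter_sets F"
  by (auto simp: filter_sets_def eventually_conj_iff)

lemma filter_sets_rel_filter_image:
  "filter_sets (rel_filter_image H F) = {A. \<exists>S\<in>filter_sets F. H `` S \<subseteq> A}"
proof -
  let ?B = "{H `` S |S. S \<in> filter_sets F}"
  have "?B \<noteq> {}"
    using filter_sets_UNIV[of F] by auto
  moreover have "\<exists>U\<in>?B. U \<subseteq> S' \<inter> T'" if ST': "S' \<in> ?B" "T' \<in> ?B" for S' T'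
  proof -
    obtain S T where ST: "S' = H `` S" "S \<in> filter_sets F"
        "T' = H `` T" "T \<in> filter_sets F"
      using ST' by blast
    then have "H `` (S \<inter> T) \<in> ?B"
      using filter_sets_Int[of S F T] by blast
    moreover have "H `` (S \<inter> T) \<subseteq> S' \<inter> T'"
      unfolding ST by auto
    ultimately show ?thesis by (rule bexI[rotated])
  qed
  ultimately have "eventually P (generated_filter ?B) \<longleftrightarrow> (\<exists>S\<in>?B. \<forall>x\<in>S. P x)" for P
    by (rule eventually_generated_filter)
  then show ?thesis
    by (auto simp: rel_filter_image_def filter_sets_def[of "generated_filter ?B"] subset_eq)
qed

lemma filter_sets_preimage_filter:
  "filter_sets (preimage_filter X f F) = {A. \<exists>S\<in>filter_sets F. X \<inter> f -` S \<subseteq> A}"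
proof -
  let ?B = "{X \<inter> f -` S |S. S \<in> filter_sets F}"
  have "?B \<noteq> {}"
    using filter_sets_UNIV[of F] by auto
  moreover have "\<exists>U\<in>?B. U \<subseteq> S' \<inter> T'" if ST': "S' \<in> ?B" "T' \<in> ?B" for S' T'
  proof -
    obtain S T where ST: "S' = X \<inter> f -` S" "S \<in> filter_sets F"
        "T' = X \<inter> f -` T" "T \<in> filter_sets F"
      using ST' by blast
    then have "X \<inter> f -` (S \<inter> T) \<in> ?B"
      using filter_sets_Int[of S F T] by blast
    moreover have "X \<inter> f -` (S \<inter> T) \<subseteq> S' \<inter> T'"
      unfolding ST by auto
    ultimately show ?thesis by (rule bexI[rotated])
  qed
  ultimately have "eventually P (generated_filter ?B) \<longleftrightarrow> (\<exists>S\<in>?B. \<forall>x\<in>S. P x)" for P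
    by (rule eventually_generated_filter)
  then show ?thesis
    by (auto simp: preimage_filter_def filter_sets_def[of "generated_filter ?B"] subset_eq)
qed

lemma proper_filter_on_sup:
  "proper_filter_on X F \<Longrightarrow> proper_filter_on X G \<Longrightarrow> proper_filter_on X (sup F G)"
  by (auto simp: proper_filter_on_def filter_on_def sup_eq_bot_iff)

lemma proper_filter_on_filtermap:
  assumes "f ` X \<subseteq> Y" "proper_filter_on X F"
  shows "proper_filter_on Y (filtermap f F)"
proof -
  have "filtermap f F \<le> filtermap f (principal X)"
    using assms(2) by (intro filtermap_mono) (simp add: proper_filter_on_def filter_on_def)
  also have "\<dots> \<le> principal Y"
    using assms(1) by (simp add: filtermap_principal)
  finally show ?thesis
    using assms(2) by (simp add: proper_filter_on_def filter_on_def filtermap_bot_iff)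
qed

lemma proper_filter_on_principal: "x \<in> X \<Longrightarrow> proper_filter_on X (principal {x})"
  by (simp add: proper_filter_on_def filter_on_def principal_eq_bot_iff)

(* The descriptions by THE denote: final and initial convergences exist and are unique. *)

lemma finer_convergence_antisym:
  "finer_convergence \<xi> \<theta> \<Longrightarrow> finer_convergence \<theta> \<xi> \<Longrightarrow> \<xi> = \<theta>"
  unfolding finer_convergence_def by (intro ext subset_antisym) blast+

lemma is_final_final_convergence:
  assumes "convergence_on X \<xi>" "f ` X \<subseteq> Y"
  shows "is_final_convergence X \<xi> Y f (final_convergence X \<xi> Y f)"
proof -
  define C where "C = {\<theta>. convergence_on Y \<theta> \<and> continuous_conv X \<xi> Y \<theta> f}"
  define L where "L = (\<lambda>F. if proper_filter_on Y F then {y\<in>Y. \<forall>\<theta>\<in>C. y \<in> \<theta> F} else {})"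
  have C: "\<And>\<theta>. \<theta> \<in> C \<Longrightarrow> convergence_on Y \<theta>" by (simp add: C_def)
  have "convergence_on Y L"
    unfolding convergence_on_def
  proof (intro conjI allI impI ballI)
    fix F G assume FG: "proper_filter_on Y F" "proper_filter_on Y G"
    show "L F \<subseteq> L G" if "G \<le> F"
      using C FG that by (fastforce simp: L_def convergence_on_def)
    have "\<theta> (sup F G) = \<theta> F \<inter> \<theta> G" if "\<theta> \<in> C" for \<theta>
      using C[OF that] FG by (simp add: convergence_on_def)
    then show "L (sup F G) = L F \<inter> L G"
      using FG proper_filter_on_sup[OF FG] by (auto simp: L_def)
  next
    fix y assume "y \<in> Y"
    then show "y \<in> L (principal {y})"
      using C proper_filter_on_principal[of y Y] by (auto simp: L_def convergence_on_def)
  qed (auto simp: L_def)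
  moreover have "continuous_conv X \<xi> Y L f"
    unfolding continuous_conv_def
  proof (intro conjI allI impI)
    fix F assume F: "proper_filter_on X F"
    have "f ` \<xi> F \<subseteq> Y"
      using assms by (auto simp: convergence_on_def)
    moreover have "f ` \<xi> F \<subseteq> \<theta> (filtermap f F)" if "\<theta> \<in> C" for \<theta>
      using that F by (simp add: C_def continuous_conv_def)
    ultimately show "f ` \<xi> F \<subseteq> L (filtermap f F)"
      using proper_filter_on_filtermap[OF assms(2) F] by (auto simp: L_def)
  qed (rule assms)
  moreover have "finer_convergence L \<theta>" if "convergence_on Y \<theta>" "continuous_conv X \<xi> Y \<theta> f" for \<theta>
    using that by (auto simp: finer_convergence_def L_def C_def)
  ultimately have L: "is_final_convergence X \<xi> Y f L"
    by (simp add: is_final_convergence_def)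
  moreover have "\<theta> = L" if "is_final_convergence X \<xi> Y f \<theta>" for \<theta>
    using that L by (intro finer_convergence_antisym) (simp_all add: is_final_convergence_def)
  ultimately show ?thesis
    unfolding final_convergence_def by (rule theI)
qed

lemma is_initial_initial_convergence:
  assumes "convergence_on Y \<tau>" "f ` X \<subseteq> Y"
  shows "is_initial_convergence X Y \<tau> f (initial_convergence X Y \<tau> f)"
proof -
  define L where "L = (\<lambda>F. if proper_filter_on X F then {x\<in>X. f x \<in> \<tau> (filtermap f F)} else {})"
  have "convergence_on X L"
    unfolding convergence_on_def
  proof (intro conjI allI impI ballI)
    fix F G assume FG: "proper_filter_on X F" "proper_filter_on X G"
    note fFG = FG[THEN proper_filter_on_filtermap[OF assms(2)]]
    show "L F \<subseteq> L G" if "G \<le> F"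
    proof -
      have "\<tau> (filtermap f F) \<subseteq> \<tau> (filtermap f G)"
        using assms(1) fFG filtermap_mono[OF that, of f] by (simp add: convergence_on_def)
      then show ?thesis using FG by (auto simp: L_def)
    qed
    have "\<tau> (filtermap f (sup F G)) = \<tau> (filtermap f F) \<inter> \<tau> (filtermap f G)"
      using assms(1) fFG by (simp add: convergence_on_def filtermap_sup)
    then show "L (sup F G) = L F \<inter> L G"
      using FG proper_filter_on_sup[OF FG] by (auto simp: L_def)
  next
    fix x assume "x \<in> X"
    then show "x \<in> L (principal {x})"
      using assms proper_filter_on_principal[of x X]
      by (auto simp: L_def convergence_on_def filtermap_principal)
  qed (auto simp: L_def)
  moreover have "continuous_conv X L Y \<tau> f"
    using assms(2) by (auto simp: continuous_conv_def L_def)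
  moreover have "finer_convergence \<theta> L" if "convergence_on X \<theta>" "continuous_conv X \<theta> Y \<tau> f" for \<theta>
    unfolding finer_convergence_def
  proof
    fix F
    show "\<theta> F \<subseteq> L F"
    proof (cases "proper_filter_on X F")
      case True
      then have "f ` \<theta> F \<subseteq> \<tau> (filtermap f F)" "\<theta> F \<subseteq> X"
        using that by (simp_all add: convergence_on_def continuous_conv_def)
      then show ?thesis
        using True by (auto simp: L_def)
    qed (use that in \<open>simp add: convergence_on_def\<close>)
  qed
  ultimately have L: "is_initial_convergence X Y \<tau> f L"
    by (simp add: is_initial_convergence_def)
  moreover have "\<theta> = L" if "is_initial_convergence X Y \<tau> f \<theta>" for \<theta>
    using that L by (intro finer_convergence_antisym) (simp_all add: is_initial_convergence_def)
  ultimately show ?thesis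
    unfolding initial_convergence_def by (rule theI)
qed

end

theory Submission
  imports Defs
begin

text \<open>
  Everything rests on the formula \<open>adh\<^bsub>f\<xi>\<^esub> H = f (adh\<^bsub>\<xi>\<^esub> (f\<^sup>- H))\<close>. Its nontrivial inclusion
  needs no explicit description of \<open>f\<xi>\<close>: the relation ``every filter \<open>H\<close> meshing with \<open>G\<close> satisfies
  \<open>y \<in> f (adh\<^bsub>\<xi>\<^esub> (f\<^sup>- H))\<close>'' is a convergence on \<open>Y\<close> making \<open>f\<close> continuous, hence it is coarser
  than \<open>f\<xi>\<close>. Given the formula, both (1) and (2) say that \<open>adh\<^bsub>\<tau>\<^esub> H \<subseteq> adh\<^bsub>f\<xi>\<^esub> H\<close> for all \<open>H\<close> of the
  class. For (3) one pulls \<open>H\<close> back along \<open>f\<close>; conversely, if \<open>y\<close> is a \<open>\<tau>\<close>-limit of \<open>G\<close>,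
  then \<open>f\<^sup>- G\<close> is compact at the fibre of \<open>y\<close> for the initial convergence, and \<open>f (f\<^sup>- G) = G\<close>.
\<close>

section \<open>Meshing as a lattice condition\<close>

lemma mesh_commute: "mesh F G \<longleftrightarrow> mesh G F"
  unfolding mesh_def by (metis Int_commute)

text \<open>The infimum of two filters is their common refinement, and it is degenerate exactly when
  some members are disjoint. Distributivity of the filter lattice and proper refinements thus become
  available for meshing.\<close>

lemma mesh_iff_inf: "mesh F G \<longleftrightarrow> inf F G \<noteq> bot"
proof -
  have "inf F G = bot \<longleftrightarrow> (\<exists>A\<in>filter_sets F. \<exists>B\<in>filter_sets G. A \<inter> B = {})"
  proof
    assume "inf F G = bot"
    then obtain P Q where "eventually P F" "eventually Q G" "\<forall>x. P x \<and> Q x \<longrightarrow> False"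
      by (auto simp: trivial_limit_def eventually_inf)
    then have "Collect P \<in> filter_sets F" "Collect Q \<in> filter_sets G" "Collect P \<inter> Collect Q = {}"
      by (auto simp: filter_sets_def)
    then show "\<exists>A\<in>filter_sets F. \<exists>B\<in>filter_sets G. A \<inter> B = {}"
      by blast
  next
    assume "\<exists>A\<in>filter_sets F. \<exists>B\<in>filter_sets G. A \<inter> B = {}"
    then show "inf F G = bot"
      unfolding filter_sets_def trivial_limit_def eventually_inf by blast
  qed
  then show ?thesis
    by (auto simp: mesh_def)
qed

lemma mesh_mono: "mesh F G \<Longrightarrow> F \<le> F' \<Longrightarrow> G \<le> G' \<Longrightarrow> mesh F' G'"
  unfolding mesh_iff_inf by (metis bot_unique inf_mono)

lemma mesh_supE:
  assumes "mesh H (sup F G)"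
  obtains "mesh H F" | "mesh H G"
  using assms by (auto simp: mesh_iff_inf inf_sup_distrib1)

section \<open>Filters as families of sets\<close>

lemma filter_on_sets: "filter_on X F \<longleftrightarrow> X \<in> filter_sets F"
  by (simp add: filter_on_def filter_sets_def le_principal)

lemma filter_sets_le: "(F \<le> G) \<longleftrightarrow> filter_sets G \<subseteq> filter_sets F"
proof
  assume *: "filter_sets G \<subseteq> filter_sets F"
  show "F \<le> G"
  proof (rule filter_leI)
    fix P assume "eventually P G"
    then have "Collect P \<in> filter_sets G"
      by (simp add: filter_sets_def)
    then have "Collect P \<in> filter_sets F"
      using * by blast
    then show "eventually P F"
      by (simp add: filter_sets_def)
  qed
qed (auto simp: filter_sets_def le_filter_def)

lemma filter_sets_inject: "filter_sets F = filter_sets G \<Longrightarrow> F = G"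
  by (simp add: antisym filter_sets_le)

lemma filter_sets_mono: "A \<in> filter_sets F \<Longrightarrow> A \<subseteq> B \<Longrightarrow> B \<in> filter_sets F"
  by (auto simp: filter_sets_def elim: eventually_mono)

lemma filter_sets_filtermap: "A \<in> filter_sets (filtermap f F) \<longleftrightarrow> f -` A \<in> filter_sets F"
  by (simp add: filter_sets_def eventually_filtermap)

section \<open>Images and preimages of filters under a map\<close>

lemma rel_filter_image_graph_on:
  assumes "filter_on X F"
  shows "rel_filter_image (graph_on X f) F = filtermap f F"
proof (rule filter_sets_inject, rule set_eqI)
  fix A
  show "A \<in> filter_sets (rel_filter_image (graph_on X f) F) \<longleftrightarrow> A \<in> filter_sets (filtermap f F)"
  proof
    assume "A \<in> filter_sets (rel_filter_image (graph_on X f) F)"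
    then obtain S where S: "S \<in> filter_sets F" "graph_on X f `` S \<subseteq> A"
      by (auto simp: filter_sets_rel_filter_image)
    then have "S \<inter> X \<subseteq> f -` A"
      by (auto simp: graph_on_def)
    then show "A \<in> filter_sets (filtermap f F)"
      using S assms by (metis filter_on_sets filter_sets_Int filter_sets_filtermap filter_sets_mono)
  next
    assume "A \<in> filter_sets (filtermap f F)"
    moreover have "graph_on X f `` (f -` A) \<subseteq> A"
      by (auto simp: graph_on_def)
    ultimately show "A \<in> filter_sets (rel_filter_image (graph_on X f) F)"
      by (auto simp: filter_sets_rel_filter_image filter_sets_filtermap)
  qed
qed

text \<open>\<open>F1_composable\<close> speaks of images under relations. Through the inverse
  graph, a preimage filter becomes such an image and so stays in the class.\<close>

lemma preimage_filter_eq_rel_filter_image: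
  "preimage_filter X f H = rel_filter_image {(f x, x) |x. x \<in> X} H"
proof -
  have "{(f x, x) |x. x \<in> X} `` S = X \<inter> f -` S" for S
    by auto
  then show ?thesis
    by (simp add: preimage_filter_def rel_filter_image_def)
qed

lemma filter_on_preimage_filter: "filter_on X (preimage_filter X f H)"
  using filter_sets_UNIV[of H] by (auto simp: filter_on_sets filter_sets_preimage_filter)

lemma filtermap_preimage_filter:
  assumes "filter_on (f ` X) G"
  shows "filtermap f (preimage_filter X f G) = G"
proof (rule filter_sets_inject, rule set_eqI)
  fix A
  have "A \<in> filter_sets G" if "S \<in> filter_sets G" "X \<inter> f -` S \<subseteq> f -` A" for S
  proof -
    have "S \<inter> f ` X \<subseteq> A"
      using that(2) by auto
    then show ?thesis
      using that(1) assms by (metis filter_on_sets filter_sets_Int filter_sets_mono)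
  qed
  then show "A \<in> filter_sets (filtermap f (preimage_filter X f G)) \<longleftrightarrow> A \<in> filter_sets G"
    by (auto simp: filter_sets_filtermap filter_sets_preimage_filter)
qed

lemma mesh_preimage_filter:
  assumes "filter_on X F"
  shows "mesh F (preimage_filter X f H) \<longleftrightarrow> mesh (filtermap f F) H"
proof
  assume L: "mesh F (preimage_filter X f H)"
  show "mesh (filtermap f F) H"
    unfolding mesh_def
  proof (intro ballI)
    fix A B assume "A \<in> filter_sets (filtermap f F)" "B \<in> filter_sets H"
    then have "f -` A \<in> filter_sets F" "X \<inter> f -` B \<in> filter_sets (preimage_filter X f H)"
      by (auto simp: filter_sets_filtermap filter_sets_preimage_filter)
    then have "f -` A \<inter> (X \<inter> f -` B) \<noteq> {}"
      using L by (simp add: mesh_def)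
    then show "A \<inter> B \<noteq> {}"
      by auto
  qed
next
  assume R: "mesh (filtermap f F) H"
  show "mesh F (preimage_filter X f H)"
    unfolding mesh_def
  proof (intro ballI)
    fix A B assume A: "A \<in> filter_sets F" and "B \<in> filter_sets (preimage_filter X f H)"
    then obtain S where S: "S \<in> filter_sets H" "X \<inter> f -` S \<subseteq> B"
      by (auto simp: filter_sets_preimage_filter)
    \<comment> \<open>\<open>A\<close> may leave \<open>X\<close>, whereas preimages are taken
      inside \<open>X\<close>; trimming \<open>A\<close> keeps the common point there.\<close>
    have "A \<inter> X \<in> filter_sets F"
      using A assms by (simp add: filter_on_sets filter_sets_Int)
    then have "f ` (A \<inter> X) \<in> filter_sets (filtermap f F)"
      unfolding filter_sets_filtermap by (rule filter_sets_mono) auto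
    then have "f ` (A \<inter> X) \<inter> S \<noteq> {}"
      using R S by (simp add: mesh_def)
    then show "A \<inter> B \<noteq> {}"
      using S(2) by auto
  qed
qed

section \<open>Adherence under final and initial convergences\<close>

lemma adhI: "proper_filter_on X G \<Longrightarrow> mesh G H \<Longrightarrow> x \<in> \<xi> G \<Longrightarrow> x \<in> adh X \<xi> H"
  by (auto simp: adh_def)

lemma adhE:
  assumes "x \<in> adh X \<xi> H"
  obtains G where "proper_filter_on X G" "mesh G H" "x \<in> \<xi> G"
  using assms by (auto simp: adh_def)

lemma convergence_on_limD:
  assumes "convergence_on X \<xi>" "x \<in> \<xi> F"
  shows "proper_filter_on X F" "x \<in> X"
proof -
  have "\<xi> F \<subseteq> X" "\<not> proper_filter_on X F \<longrightarrow> \<xi> F = {}"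
    using assms(1) by (simp_all add: convergence_on_def)
  then show "proper_filter_on X F" "x \<in> X"
    using assms(2) by blast+
qed

lemma adh_subset: "convergence_on X \<xi> \<Longrightarrow> adh X \<xi> H \<subseteq> X"
  by (auto elim!: adhE dest: convergence_on_limD)

text \<open>If \<open>G\<close> witnesses adherence upstairs, its image filter witnesses it
  downstairs. This serves for both the final and the initial convergence.\<close>

lemma continuous_conv_image_adh:
  assumes "continuous_conv X \<xi> Y \<theta> f"
  shows "f ` adh X \<xi> (preimage_filter X f H) \<subseteq> adh Y \<theta> H"
proof
  fix y assume "y \<in> f ` adh X \<xi> (preimage_filter X f H)"
  then obtain x G where xG: "y = f x" "proper_filter_on X G"
      "mesh G (preimage_filter X f H)" "x \<in> \<xi> G"
    by (auto elim: adhE)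
  have f: "f ` X \<subseteq> Y" "f ` \<xi> G \<subseteq> \<theta> (filtermap f G)"
    using assms xG(2) by (simp_all add: continuous_conv_def)
  have "proper_filter_on Y (filtermap f G)"
    using f(1) xG(2) by (rule proper_filter_on_filtermap)
  moreover have "mesh (filtermap f G) H"
    using xG(2,3) by (simp add: mesh_preimage_filter proper_filter_on_def)
  moreover have "y \<in> \<theta> (filtermap f G)"
    using f(2) xG(1,4) by blast
  ultimately show "y \<in> adh Y \<theta> H"
    by (intro adhI)
qed

lemma adh_final_convergence:
  assumes \<xi>: "convergence_on X \<xi>" and surj: "f ` X = Y"
  shows "adh Y (final_convergence X \<xi> Y f) H = f ` adh X \<xi> (preimage_filter X f H)"
proof
  define \<theta> where "\<theta> = (\<lambda>G. if proper_filter_on Y G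
      then {y\<in>Y. \<forall>K. mesh K G \<longrightarrow> y \<in> f ` adh X \<xi> (preimage_filter X f K)} else {})"
  have final: "is_final_convergence X \<xi> Y f (final_convergence X \<xi> Y f)"
    by (rule is_final_final_convergence) (use assms in auto)
  then show "f ` adh X \<xi> (preimage_filter X f H) \<subseteq> adh Y (final_convergence X \<xi> Y f) H"
    by (intro continuous_conv_image_adh) (simp add: is_final_convergence_def)
  have lim_image: "f ` \<xi> F \<subseteq> \<theta> (filtermap f F)" if F: "proper_filter_on X F" for F
  proof -
    have "x \<in> adh X \<xi> (preimage_filter X f K)" if "x \<in> \<xi> F" "mesh K (filtermap f F)" for x K
    proof (rule adhI)
      show "mesh F (preimage_filter X f K)"
        using that(2) F mesh_commute[of K] by (simp add: mesh_preimage_filter proper_filter_on_def)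
    qed (use that F in auto)
    then show ?thesis
      using F surj proper_filter_on_filtermap[of f X Y F] convergence_on_limD[OF \<xi>]
      by (auto simp: \<theta>_def)
  qed
  have "convergence_on Y \<theta>"
    unfolding convergence_on_def
  proof (intro conjI allI impI ballI)
    fix F G assume FG: "proper_filter_on Y F" "proper_filter_on Y G"
    show "\<theta> F \<subseteq> \<theta> G" if "G \<le> F"
    proof -
      have "mesh K F" if "mesh K G" for K
        using mesh_mono[OF that order_refl \<open>G \<le> F\<close>] .
      then show ?thesis
        using FG by (auto simp: \<theta>_def)
    qed
    \<comment> \<open>The filters \<open>K\<close> tested for \<open>sup F G\<close> are those
      tested for \<open>F\<close> together with those tested for \<open>G\<close>, so the conditions
      combine to an intersection.\<close>
    have "mesh K (sup F G) \<longleftrightarrow> mesh K F \<or> mesh K G" for K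
      using mesh_mono[of K F K "sup F G"] mesh_mono[of K G K "sup F G"] by (auto elim: mesh_supE)
    then show "\<theta> (sup F G) = \<theta> F \<inter> \<theta> G"
      using FG proper_filter_on_sup[OF FG] by (auto simp: \<theta>_def)
  next
    fix y assume "y \<in> Y"
    then obtain x where x: "x \<in> X" "y = f x"
      using surj by auto
    then have "x \<in> \<xi> (principal {x})"
      using \<xi> by (simp add: convergence_on_def)
    then show "y \<in> \<theta> (principal {y})"
      \<comment> \<open>Surjectivity makes the principal filter at \<open>y\<close> the image of one
        at \<open>x\<close>, so convergence at \<open>y\<close> is inherited from \<xi>.\<close>
      using lim_image[OF proper_filter_on_principal[OF x(1)]] x by (auto simp: filtermap_principal)
  qed (auto simp: \<theta>_def)
  moreover have "continuous_conv X \<xi> Y \<theta> f"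
    using surj lim_image by (simp add: continuous_conv_def)
  ultimately have finer: "finer_convergence (final_convergence X \<xi> Y f) \<theta>"
    using final by (simp add: is_final_convergence_def)
  show "adh Y (final_convergence X \<xi> Y f) H \<subseteq> f ` adh X \<xi> (preimage_filter X f H)"
  proof
    fix y assume "y \<in> adh Y (final_convergence X \<xi> Y f) H"
    then obtain G where G: "proper_filter_on Y G" "mesh G H" "y \<in> \<theta> G"
      using finer by (auto simp: finer_convergence_def elim!: adhE)
    then have "\<forall>K. mesh K G \<longrightarrow> y \<in> f ` adh X \<xi> (preimage_filter X f K)"
      by (simp add: \<theta>_def)
    then show "y \<in> f ` adh X \<xi> (preimage_filter X f H)"
      using G(2) mesh_commute by blast
  qed
qed

text \<open>\<open>initial_convergence\<close> is known only by its universal property. The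
  pointwise formula defines a convergence making \<open>f\<close> continuous, hence one finer than
  the initial convergence, whose limits therefore include those of the formula.\<close>

lemma initial_convergenceI:
  assumes \<tau>: "convergence_on Y \<tau>" and f: "f ` X \<subseteq> Y"
    and F: "proper_filter_on X F" and x: "x \<in> X" "f x \<in> \<tau> (filtermap f F)"
  shows "x \<in> initial_convergence X Y \<tau> f F"
proof -
  define \<theta> where "\<theta> = (\<lambda>F. if proper_filter_on X F then {x\<in>X. f x \<in> \<tau> (filtermap f F)} else {})"
  have "convergence_on X \<theta>"
    unfolding convergence_on_def
  proof (intro conjI allI impI ballI)
    fix F G assume FG: "proper_filter_on X F" "proper_filter_on X G"
    note fFG = FG[THEN proper_filter_on_filtermap[OF f]]
    show "\<theta> F \<subseteq> \<theta> G" if "G \<le> F"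
    proof -
      have "\<tau> (filtermap f F) \<subseteq> \<tau> (filtermap f G)"
        using \<tau> fFG filtermap_mono[OF that, of f] by (simp add: convergence_on_def)
      then show ?thesis
        using FG by (auto simp: \<theta>_def)
    qed
    have "\<tau> (filtermap f (sup F G)) = \<tau> (filtermap f F) \<inter> \<tau> (filtermap f G)"
      using \<tau> fFG by (simp add: convergence_on_def filtermap_sup)
    then show "\<theta> (sup F G) = \<theta> F \<inter> \<theta> G"
      using FG proper_filter_on_sup[OF FG] by (auto simp: \<theta>_def)
  next
    fix x assume "x \<in> X"
    then show "x \<in> \<theta> (principal {x})"
      using \<tau> f proper_filter_on_principal[of x X]
      by (auto simp: \<theta>_def convergence_on_def filtermap_principal)
  qed (auto simp: \<theta>_def)
  moreover have "continuous_conv X \<theta> Y \<tau> f"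
    using f by (auto simp: continuous_conv_def \<theta>_def)
  ultimately have "finer_convergence \<theta> (initial_convergence X Y \<tau> f)"
    using is_initial_initial_convergence[OF \<tau> f] by (simp add: is_initial_convergence_def)
  moreover have "x \<in> \<theta> F"
    using F x by (simp add: \<theta>_def)
  ultimately show ?thesis
    by (auto simp: finer_convergence_def)
qed

section \<open>The three conditions as inclusions of adherences\<close>

lemma finer_Adh_iff:
  assumes "convergence_on Y \<tau>"
  shows "finer_convergence \<tau> (Adh D Y \<sigma>) \<longleftrightarrow> (\<forall>H\<in>D Y. adh Y \<tau> H \<subseteq> adh Y \<sigma> H)"
proof
  assume L: "finer_convergence \<tau> (Adh D Y \<sigma>)"
  show "\<forall>H\<in>D Y. adh Y \<tau> H \<subseteq> adh Y \<sigma> H"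
  proof (intro ballI subsetI)
    fix H y assume H: "H \<in> D Y" and "y \<in> adh Y \<tau> H"
    then obtain G where G: "proper_filter_on Y G" "mesh G H" "y \<in> \<tau> G"
      by (elim adhE)
    then have "y \<in> Adh D Y \<sigma> G"
      using L by (auto simp: finer_convergence_def)
    then show "y \<in> adh Y \<sigma> H"
      using G H by (simp add: Adh_def mesh_commute)
  qed
next
  assume R: "\<forall>H\<in>D Y. adh Y \<tau> H \<subseteq> adh Y \<sigma> H"
  show "finer_convergence \<tau> (Adh D Y \<sigma>)"
    unfolding finer_convergence_def
  proof (intro allI subsetI)
    fix F y assume y: "y \<in> \<tau> F"
    note F = convergence_on_limD[OF assms y]
    \<comment> \<open>\<open>F\<close> itself witnesses that \<open>y\<close> is in the
      \<tau>-adherence of each \<open>H\<close> meshing with it.\<close>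
    have "y \<in> adh Y \<sigma> H" if "H \<in> D Y" "mesh H F" for H
    proof -
      have "y \<in> adh Y \<tau> H"
        using F(1) y that(2) by (intro adhI[of _ F]) (auto simp: mesh_commute)
      then show ?thesis
        using R that(1) by blast
    qed
    then show "y \<in> Adh D Y \<sigma> F"
      using F by (simp add: Adh_def)
  qed
qed

text \<open>The common refinement of \<open>K\<close> and the preimage of \<open>G\<close> has an
  image finer than \<open>G\<close>, hence \<tau>-convergent to \<open>y\<close>. In the initial
  convergence it therefore converges to any point of the fibre, and surjectivity provides
  one.\<close>

lemma D_compact_at_fibre:
  assumes D: "is_filter_class D" and \<tau>: "convergence_on Y \<tau>" and surj: "f ` X = Y"
    and y: "y \<in> \<tau> G"
  shows "D_compact_at D X (initial_convergence X Y \<tau> f) (preimage_filter X f G) (X \<inter> f -` {y})"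
  unfolding D_compact_at_def
proof (intro ballI impI)
  fix K assume K: "K \<in> D X" "mesh K (preimage_filter X f G)"
  note G = convergence_on_limD[OF \<tau> y]
  obtain x where x: "x \<in> X" "f x = y"
    using G(2) surj by auto
  let ?M = "inf K (preimage_filter X f G)"
  have "K \<le> principal X"
    using D K(1) by (auto simp: is_filter_class_def filter_on_def)
  then have M: "proper_filter_on X ?M"
    using K(2) by (simp add: proper_filter_on_def filter_on_def mesh_iff_inf le_infI1)
  have "filtermap f ?M \<le> filtermap f (preimage_filter X f G)"
    by (simp add: filtermap_mono)
  also have "\<dots> = G"
    using G(1) surj by (intro filtermap_preimage_filter) (simp add: proper_filter_on_def)
  finally have "\<tau> G \<subseteq> \<tau> (filtermap f ?M)"
    using \<tau> G(1) proper_filter_on_filtermap[OF _ M, of f Y] surj by (simp add: convergence_on_def)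
  then have "x \<in> initial_convergence X Y \<tau> f ?M"
    using M x y surj by (intro initial_convergenceI[OF \<tau>]) auto
  moreover have "mesh ?M K"
    using M by (simp add: mesh_iff_inf proper_filter_on_def inf.absorb1)
  ultimately have "x \<in> adh X (initial_convergence X Y \<tau> f) K"
    using M by (intro adhI)
  then show "adh X (initial_convergence X Y \<tau> f) K \<inter> (X \<inter> f -` {y}) \<noteq> {}"
    using x by auto
qed

lemma graph_on_Image: "A \<subseteq> X \<Longrightarrow> graph_on X f `` A = f ` A"
  by (auto simp: graph_on_def)

lemma D_compact_relation_iff:
  assumes D: "is_filter_class D" and comp: "F1_composable D"
    and \<tau>: "convergence_on Y \<tau>" and surj: "f ` X = Y"
  shows "D_compact_relation D X (initial_convergence X Y \<tau> f) Y \<sigma> (graph_on X f) \<longleftrightarrow>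
    (\<forall>H\<in>D Y. adh Y \<tau> H \<subseteq> adh Y \<sigma> H)"
proof
  assume L: "D_compact_relation D X (initial_convergence X Y \<tau> f) Y \<sigma> (graph_on X f)"
  show "\<forall>H\<in>D Y. adh Y \<tau> H \<subseteq> adh Y \<sigma> H"
  proof (intro ballI subsetI)
    fix H y assume H: "H \<in> D Y" and "y \<in> adh Y \<tau> H"
    then obtain G where G: "proper_filter_on Y G" "mesh G H" "y \<in> \<tau> G"
      by (elim adhE)
    let ?A = "X \<inter> f -` {y}"
    have "rel_filter_image (graph_on X f) (preimage_filter X f G) = G"
      using G(1) surj rel_filter_image_graph_on[OF filter_on_preimage_filter, of X f f G]
      by (simp add: filtermap_preimage_filter proper_filter_on_def)
    then have "D_compact_at D Y \<sigma> G (graph_on X f `` ?A)"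
      using L D_compact_at_fibre[OF D \<tau> surj G(3)] filter_on_preimage_filter[of X f G]
      unfolding D_compact_relation_def by (metis inf_le1)
    \<comment> \<open>The image of the fibre contains no point but \<open>y\<close>, so a nonempty
      intersection already places \<open>y\<close> in the adherence.\<close>
    then have "adh Y \<sigma> H \<inter> (f ` ?A) \<noteq> {}"
      using H G(2) by (simp add: D_compact_at_def mesh_commute graph_on_Image)
    then show "y \<in> adh Y \<sigma> H"
      by auto
  qed
next
  assume R: "\<forall>H\<in>D Y. adh Y \<tau> H \<subseteq> adh Y \<sigma> H"
  have cont: "continuous_conv X (initial_convergence X Y \<tau> f) Y \<tau> f"
    using is_initial_initial_convergence[OF \<tau>, of f X] surj by (simp add: is_initial_convergence_def)
  have "D_compact_at D Y \<sigma> (rel_filter_image (graph_on X f) F) (graph_on X f `` A)"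
    if A: "A \<subseteq> X" and F: "filter_on X F"
      and FA: "D_compact_at D X (initial_convergence X Y \<tau> f) F A" for A F
    unfolding D_compact_at_def rel_filter_image_graph_on[OF F] graph_on_Image[OF A]
  proof (intro ballI impI)
    fix H assume H: "H \<in> D Y" "mesh H (filtermap f F)"
    \<comment> \<open>Composability with the inverse graph puts the preimage of \<open>H\<close> in
      \<open>D X\<close>, where compactness of \<open>F\<close> at \<open>A\<close> can be tested
      against it.\<close>
    have "{(f x, x) |x. x \<in> X} \<subseteq> Y \<times> X"
      using surj by auto
    then have "preimage_filter X f H \<in> D X"
      using comp H(1) unfolding F1_composable_def preimage_filter_eq_rel_filter_image by blast
    moreover have "mesh (preimage_filter X f H) F"
      using H(2) F mesh_preimage_filter mesh_commute by blast
    ultimately obtain x where x: "x \<in> A"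
      "x \<in> adh X (initial_convergence X Y \<tau> f) (preimage_filter X f H)"
      using FA by (auto simp: D_compact_at_def)
    then have "f x \<in> adh Y \<sigma> H"
      using continuous_conv_image_adh[OF cont, of H] R H(1) by blast
    then show "adh Y \<sigma> H \<inter> f ` A \<noteq> {}"
      using x(1) by auto
  qed
  moreover have "graph_on X f \<subseteq> X \<times> Y"
    using surj by (auto simp: graph_on_def)
  ultimately show "D_compact_relation D X (initial_convergence X Y \<tau> f) Y \<sigma> (graph_on X f)"
    by (simp add: D_compact_relation_def)
qed

lemma D_quotient_iff:
  assumes \<xi>: "convergence_on X \<xi>" and \<tau>: "convergence_on Y \<tau>" and surj: "f ` X = Y"
  shows "D_quotient D X \<xi> Y \<tau> f \<longleftrightarrow>
    (\<forall>H\<in>D Y. adh Y \<tau> H \<subseteq> adh Y (final_convergence X \<xi> Y f) H)"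
proof -
  \<comment> \<open>Meeting the fibre of \<open>y\<close> means that \<open>y\<close> is in the
    image of the adherence, which \<open>adh_final_convergence\<close> identifies.\<close>
  have "(X \<inter> f -` {y}) \<inter> adh X \<xi> K \<noteq> {} \<longleftrightarrow> y \<in> f ` adh X \<xi> K" for y K
    using adh_subset[OF \<xi>, of K] by auto
  then have "D_quotient D X \<xi> Y \<tau> f \<longleftrightarrow> (\<forall>H\<in>D Y. \<forall>y\<in>Y. y \<in> adh Y \<tau> H \<longrightarrow>
      y \<in> adh Y (final_convergence X \<xi> Y f) H)"
    using surj by (simp add: D_quotient_def adh_final_convergence[OF \<xi> surj])
  also have "\<dots> \<longleftrightarrow> (\<forall>H\<in>D Y. adh Y \<tau> H \<subseteq> adh Y (final_convergence X \<xi> Y f) H)"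
    using adh_subset[OF \<tau>] by blast
  finally show ?thesis .
qed

theorem theorem14:
  fixes D :: "'u filter_class"
    and X Y :: "'u set"
    and \<xi> \<tau> :: "'u limit_fun"
    and f :: "'u \<Rightarrow> 'u"
  assumes "is_filter_class D"
    and "F1_composable D"
    and "convergence_on X \<xi>"
    and "convergence_on Y \<tau>"
    and "f ` X = Y"
  shows "(D_quotient D X \<xi> Y \<tau> f \<longleftrightarrow>
            finer_convergence \<tau> (Adh D Y (final_convergence X \<xi> Y f))) \<and>
         (finer_convergence \<tau> (Adh D Y (final_convergence X \<xi> Y f)) \<longleftrightarrow>
            D_compact_relation D X (initial_convergence X Y \<tau> f)
              Y (final_convergence X \<xi> Y f) (graph_on X f))"
  using D_quotient_iff[OF assms(3-5)] finer_Adh_iff[OF assms(4)]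
    D_compact_relation_iff[OF assms(1,2,4,5)]
  by simp

end
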